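(* Let $\mathcal D$ be a family of probability distributions over $\mathcal X^n$, $\mathcal Q$ a family of queries, and $\bar M=(M_1,\dots,M_k)$ a sequence of $k$ mechanisms $M_i:\mathcal X^n\times\mathcal Q\to\mathcal R$. Let $\mathcal D_{M_0,\mathcal Q}:=\mathcal D$ and, for $i>0$, let $\mathcal D_{M_i,\mathcal Q}$ be the set of all posterior distributions on $\mathcal X^n$ induced by any response of $M_i$ with non-zero probability with respect to $\mathcal D_{M_{i-1},\mathcal Q}$ and $\mathcal Q$. Let $0<\epsilon_1,\dots,\epsilon_k\le1$ and $0\le\delta_1,\dots,\delta_k\le 1$, and suppose that for every $i$, $M_i$ is $(\epsilon_i,\delta_i)$-LSS with respect to $\mathcal D_{M_{i-1},\mathcal Q}$ and $\mathcal Q$. Let $0\le\alpha_1,\dots,\alpha_k\le1$ be such that for every $i$, every $D_{\mathcal X^n}\in\mathcal D_{M_{i-1},\mathcal Q}$ and every $q\in\mathcal Q$, $$\mathbb E_{S\sim D_{\mathcal X^n},\,R\sim M_i(S,q)}[\ell(R)]\le\alpha_i,$$ where $\ell$ is the stability loss with respect to $D_{\mathcal X^n}$, $q$ and $M_i$. Then for any $0<\delta'\le1$, the sequence $\bar M$ is $\left(\epsilon',\ \delta'+\sum_{i=1}^k\frac{\delta_i}{\epsilon_i}\right)$-$k$-LSS with respect to $\mathcal D$ and any analyst $A$ that issues queries in $\mathcal Q$ and receives responses in $\mathcal R$, where $$\epsilon':=\sqrt{8\ln\left(\tfrac1{\delta'}\right)\sum_{i=1}^k\epsilon_i^2}+\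sum_{i=1}^k\alpha_i.$$
   Context: $\mathcal X$, $\mathcal Q$, $\mathcal R$ are countable sets and $n\in\mathbb N$. A mechanism $M:\mathcal X^n\times\mathcal Q\to\mathcal R$ is a possibly randomized function; for a distribution $D_{\mathcal X^n}$ on $\mathcal X^n$ and a fixed $q$, write $D(r\mid s)=\Pr[M(s,q)=r]$, $D(s)=D_{\mathcal X^n}(s)$, $D(r)=\sum_sD(s)D(r\mid s)$, $D(s\mid r)=D(s)D(r\mid s)/D(r)$. For $s=(s_1,\dots,s_n)$, $D(x\mid s)=\frac1n|\{i:s_i=x\}|$; $D(x)=\sum_sD(s)D(x\mid s)$; $D(x\mid r)=\sum_sD(s\mid r)D(x\mid s)$. Only $r$ with $D(r)>0$ matter. Stability loss: $\ell(r)=\sum_{x:\,D(x\mid r)>D(x)}(D(x\mid r)-D(x))$. $M$ is $(\epsilon,\delta)$-LSS (Local-Statistically Stable) with respect to $D_{\mathcal X^n}$ and $q$ if for every $\mathbf r\subseteq\mathcal R$, $\sum_{r\in\mathbf r}D(r)(\ell(r)-\epsilon)\le\delta$; with respect to families of distributions and queries if this holds for every member of the families. (The inequality makes sense, and holds trivially, when $\epsilon\ge1$ or $\delta\ge1$.) Posterior family: $\mathcal D_{M_i,\mathcal Q}$ consists of all distributions $s\mapsto P(s)\Pr[M_i(s,q)=r]/\sum_{s'}P(s')\Pr[M_i(s',q)=r]$ with $P\in\mathcal D_{M_{i-1},\mathcal Q}$, $q\in\mathcal Q$, $r\in\mathcal R$ and positive denominator. Adaptivity: an analyst is a possibly randomized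 function $A:\mathcal R^*\to\mathcal Q$ mapping a finite sequence of responses to a query. The adaptive mechanism $\mathrm{Adp}_{\bar M}$, on input $s\in\mathcal X^n$ and $A$, does the following: $v_0\leftarrow\emptyset$ (if $A$ is randomized, $v_0\leftarrow c$ where $c$ are $A$'s coin tosses, drawn independently of $s$ from a discrete distribution; then $A$ is a deterministic function of the view); for $i=1,\dots,k$: $q_i\leftarrow A(v_{i-1})$, $r_i\leftarrow M_i(s,q_i)$ (fresh randomness), $v_i\leftarrow(v_{i-1},r_i)$. It outputs the view $v_k$. Viewing $A$ as the "query" and $v_k$ as the "response", $\mathrm{Adp}_{\bar M}$ is itself a mechanism; $\bar M$ is called $(\epsilon,\delta)$-$k$-LSS with respect to $D_{\mathcal X^n}$ and $A$ if $\mathrm{Adp}_{\bar M}$ is $(\epsilon,\delta)$-LSS with respect to $D_{\mathcal X^n}$ and $A$, and with respect to a family $\mathcal D$ if this holds for each $D_{\mathcal X^n}\in\mathcal D$. *)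

theory Defs
  imports "HOL-Probability.Probability"
begin

(* Elements of X^n are vectors over a finite index type 'n, with n = CARD('n) >= 1.
   A randomized mechanism maps a sample and a query to the distribution of its response.
   With M, P, q fixed, the usual overloaded notation corresponds to
     D(s) = pmf P s,  D(r | s) = pmf (M s q) r,  D(r) = response_prob,  D(s | r) = posterior,
     D(x | s) = elem_prob_sample,  D(x) = elem_prob,  D(x | r) = elem_prob_response. *)
type_synonym ('x, 'n, 'q, 'r) mechanism = "'x ^ 'n \<Rightarrow> 'q \<Rightarrow> 'r pmf"

definition response_prob ::
  "('x, 'n::finite, 'q, 'r) mechanism \<Rightarrow> ('x ^ 'n) pmf \<Rightarrow> 'q \<Rightarrow> 'r \<Rightarrow> real" where
  "response_prob M P q r = (\<Sum>\<^sub>\<infinity>s. pmf P s * pmf (M s q) r)"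

(* Only meaningful when the response has positive probability; otherwise 0 by x / 0 = 0. *)
definition posterior ::
  "('x, 'n::finite, 'q, 'r) mechanism \<Rightarrow> ('x ^ 'n) pmf \<Rightarrow> 'q \<Rightarrow> 'r \<Rightarrow> 'x ^ 'n \<Rightarrow> real" where
  "posterior M P q r s = pmf P s * pmf (M s q) r / response_prob M P q r"

definition elem_prob_sample :: "'x ^ 'n::finite \<Rightarrow> 'x \<Rightarrow> real" where
  "elem_prob_sample s x = real (card {i. s $ i = x}) / real CARD('n)"

definition elem_prob :: "('x ^ 'n::finite) pmf \<Rightarrow> 'x \<Rightarrow> real" where
  "elem_prob P x = (\<Sum>\<^sub>\<infinity>s. pmf P s * elem_prob_sample s x)"

definition elem_prob_response ::
  "('x, 'n::finite, 'q, 'r) mechanism \<Rightarrow> ('x ^ 'n) pmf \<Rightarrow> 'q \<Rightarrow> 'r \<Rightarrow> 'x \<Rightarrow> real" where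
  "elem_prob_response M P q r x = (\<Sum>\<^sub>\<infinity>s. posterior M P q r s * elem_prob_sample s x)"

definition stability_loss ::
  "('x, 'n::finite, 'q, 'r) mechanism \<Rightarrow> ('x ^ 'n) pmf \<Rightarrow> 'q \<Rightarrow> 'r \<Rightarrow> real" where
  "stability_loss M P q r =
     (\<Sum>\<^sub>\<infinity>x\<in>{x. elem_prob_response M P q r x > elem_prob P x}.
        elem_prob_response M P q r x - elem_prob P x)"

definition expected_stability_loss ::
  "('x, 'n::finite, 'q, 'r) mechanism \<Rightarrow> ('x ^ 'n) pmf \<Rightarrow> 'q \<Rightarrow> real" where
  "expected_stability_loss M P q =
     measure_pmf.expectation (bind_pmf P (\<lambda>s. M s q)) (stability_loss M P q)"

definition LSS ::
  "real \<Rightarrow> real \<Rightarrow> ('x, 'n::finite, 'q, 'r) mechanism \<Rightarrow> ('x ^ 'n) pmf \<Rightarrow> 'q \<Rightarrow> bool" where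
  "LSS \<epsilon> \<delta> M P q \<longleftrightarrow>
     (\<forall>B. (\<Sum>\<^sub>\<infinity>r\<in>B. response_prob M P q r * (stability_loss M P q r - \<epsilon>)) \<le> \<delta>)"

definition LSS_family ::
  "real \<Rightarrow> real \<Rightarrow> ('x, 'n::finite, 'q, 'r) mechanism \<Rightarrow> ('x ^ 'n) pmf set \<Rightarrow> 'q set \<Rightarrow> bool" where
  "LSS_family \<epsilon> \<delta> M \<D> Q \<longleftrightarrow> (\<forall>P\<in>\<D>. \<forall>q\<in>Q. LSS \<epsilon> \<delta> M P q)"

(* Sequences of mechanisms are indexed from 1, so M 0 is never used. *)
primrec posterior_family ::
  "(nat \<Rightarrow> ('x, 'n::finite, 'q, 'r) mechanism) \<Rightarrow> 'q set \<Rightarrow> ('x ^ 'n) pmf set \<Rightarrow> nat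
     \<Rightarrow> ('x ^ 'n) pmf set" where
  "posterior_family M Q \<D> 0 = \<D>"
| "posterior_family M Q \<D> (Suc i) =
     {P'. \<exists>P\<in>posterior_family M Q \<D> i. \<exists>q\<in>Q. \<exists>r.
            response_prob (M (Suc i)) P q r > 0 \<and>
            (\<forall>s. pmf P' s = posterior (M (Suc i)) P q r s)}"

(* A view consists of the analyst's coin tosses and the responses so far, oldest first.
   An analyst is a coin distribution together with a deterministic function of the view;
   a deterministic analyst is one whose coin distribution is a point mass. *)
type_synonym ('c, 'r) view = "'c \<times> 'r list"
type_synonym ('c, 'r, 'q) analyst = "'c pmf \<times> (('c, 'r) view \<Rightarrow> 'q)"

definition issues_queries_in :: "('c, 'r, 'q) analyst \<Rightarrow> 'q set \<Rightarrow> bool" where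
  "issues_queries_in A Q \<longleftrightarrow> (\<forall>c\<in>set_pmf (fst A). \<forall>rs. snd A (c, rs) \<in> Q)"

primrec adaptive_mechanism ::
  "(nat \<Rightarrow> ('x, 'n::finite, 'q, 'r) mechanism) \<Rightarrow> nat
     \<Rightarrow> ('x, 'n, ('c, 'r, 'q) analyst, ('c, 'r) view) mechanism" where
  "adaptive_mechanism M 0 = (\<lambda>s A. map_pmf (\<lambda>c. (c, [])) (fst A))"
| "adaptive_mechanism M (Suc i) =
     (\<lambda>s A. bind_pmf (adaptive_mechanism M i s A)
        (\<lambda>v. map_pmf (\<lambda>r. (fst v, snd v @ [r])) (M (Suc i) s (snd A v))))"

definition k_LSS ::
  "nat \<Rightarrow> real \<Rightarrow> real \<Rightarrow> (nat \<Rightarrow> ('x, 'n::finite, 'q, 'r) mechanism) \<Rightarrow> ('x ^ 'n) pmf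
     \<Rightarrow> ('c, 'r, 'q) analyst \<Rightarrow> bool" where
  "k_LSS k \<epsilon> \<delta> M P A \<longleftrightarrow> LSS \<epsilon> \<delta> (adaptive_mechanism M k) P A"

definition k_LSS_family ::
  "nat \<Rightarrow> real \<Rightarrow> real \<Rightarrow> (nat \<Rightarrow> ('x, 'n::finite, 'q, 'r) mechanism) \<Rightarrow> ('x ^ 'n) pmf set
     \<Rightarrow> ('c, 'r, 'q) analyst \<Rightarrow> bool" where
  "k_LSS_family k \<epsilon> \<delta> M \<D> A \<longleftrightarrow> (\<forall>P\<in>\<D>. k_LSS k \<epsilon> \<delta> M P A)"

end

theory Submission
  imports Defs
begin

text \<open>The stability loss is half the \<open>L\<^sup>1\<close> distance between the prior and the posterior law of a
  sample element. By the triangle inequality the loss of a view is at most the sum of the losses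
  of its steps, each taken relative to the posterior given the preceding view. A step loses more
  than \<open>2 * \<epsilon> i\<close> with probability at most \<open>\<delta> i / \<epsilon> i\<close>; clipping the step losses at \<open>2 * \<epsilon> i\<close> leaves a
  sum with bounded increments of conditional mean at most \<open>\<alpha> i\<close>, to which the Azuma--Hoeffding
  argument applies.\<close>

section \<open>Sums over a discrete distribution\<close>

text \<open>Bridge from the unordered sums of the definitions to Bochner integrals: integrability
  against \<open>p\<close> is absolute summability of the weighted terms, where the two
  agree.\<close>

lemma pmf_infsum_eq_integral:
  fixes f :: "'a \<Rightarrow> real"
  assumes "integrable (measure_pmf p) f"
  shows "(\<Sum>\<^sub>\<infinity>x\<in>B. pmf p x * f x) = (\<integral>x. indicat_real B x * f x \<partial>measure_pmf p)"
proof -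
  have "integrable (count_space UNIV) (\<lambda>x. pmf p x * f x)"
    using assms by (subst (asm) measure_pmf_eq_density, subst (asm) integrable_density) auto
  then have "Infinite_Set_Sum.abs_summable_on (\<lambda>x. pmf p x * f x) UNIV"
    by (simp add: Infinite_Set_Sum.abs_summable_on_def)
  then have "Infinite_Set_Sum.abs_summable_on (\<lambda>x. pmf p x * f x) B"
    by (rule Infinite_Set_Sum.abs_summable_on_subset) simp
  then have "(\<Sum>\<^sub>\<infinity>x\<in>B. pmf p x * f x) = infsetsum (\<lambda>x. pmf p x * f x) B"
    by (simp add: infsetsum_infsum)
  also have "\<dots> = infsetsum (\<lambda>x. pmf p x * (indicat_real B x * f x)) UNIV"
    by (rule infsetsum_cong_neutral) auto
  finally show ?thesis by (simp add: pmf_expectation_eq_infsetsum)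
qed

lemma pmf_summable_on: "pmf p summable_on B"
  by (meson abs_summable_equivalent abs_summable_summable pmf_abs_summable)

lemma infsum_pmf_eq_1: "(\<Sum>\<^sub>\<infinity>x. pmf p x) = 1"
  using pmf_infsum_eq_integral[of p "\<lambda>_. 1" UNIV] by simp

section \<open>Posterior distributions\<close>

text \<open>As \<open>h\<close> is injective, only the pair \<open>(x, y)\<close> yields
  \<open>h x y\<close>, so a single term of the mixture survives.\<close>

lemma pmf_bind_map_inj:
  assumes "inj (\<lambda>(x, y). h x y)"
  shows "pmf (bind_pmf p (\<lambda>x. map_pmf (h x) (K x))) (h x y) = pmf p x * pmf (K x) y"
proof -
  have "pmf (map_pmf (Pair u) (K u)) (x, y) = indicator {x} u * pmf (K x) y" for u
  proof (cases "u = x")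
    case True
    then show ?thesis by (simp add: pmf_map_inj' inj_on_def)
  next
    case False
    then show ?thesis by (auto simp: pmf_eq_0_set_pmf)
  qed
  then have "pmf (bind_pmf p (\<lambda>x. map_pmf (Pair x) (K x))) (x, y) = pmf p x * pmf (K x) y"
    by (simp add: pmf_bind measure_pmf_single)
  moreover have "bind_pmf p (\<lambda>x. map_pmf (h x) (K x)) =
      map_pmf (\<lambda>(x, y). h x y) (bind_pmf p (\<lambda>x. map_pmf (Pair x) (K x)))"
    by (simp add: map_bind_pmf pmf.map_comp comp_def)
  ultimately show ?thesis
    using pmf_map_inj'[OF assms, of _ "(x, y)"] by simp
qed

text \<open>Bayes' rule as a genuine \<open>pmf\<close>, so that a posterior can serve as the prior
  of the next round. The weights sum to 1, as \<open>embed_pmf\<close> requires, only for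
  \<open>r\<close> in the support of \<open>bind_pmf P K\<close>.\<close>

definition posterior_pmf :: "'s pmf \<Rightarrow> ('s \<Rightarrow> 'r pmf) \<Rightarrow> 'r \<Rightarrow> 's pmf" where
  "posterior_pmf P K r = embed_pmf (\<lambda>s. pmf P s * pmf (K s) r / pmf (bind_pmf P K) r)"

lemma pmf_posterior_pmf:
  assumes "r \<in> set_pmf (bind_pmf P K)"
  shows "pmf (posterior_pmf P K r) s = pmf P s * pmf (K s) r / pmf (bind_pmf P K) r"
  unfolding posterior_pmf_def
proof (rule pmf_embed_pmf)
  have pos: "pmf (bind_pmf P K) r > 0"
    using assms by (rule pmf_positive)
  have "(\<integral>\<^sup>+ s. ennreal (pmf P s * pmf (K s) r / pmf (bind_pmf P K) r) \<partial>count_space UNIV)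
      = (\<integral>\<^sup>+ s. ennreal (pmf P s) * ennreal (pmf (K s) r) \<partial>count_space UNIV) / pmf (bind_pmf P K) r"
    using pos by (simp add: nn_integral_divide ennreal_mult flip: divide_ennreal)
  also have "(\<integral>\<^sup>+ s. ennreal (pmf P s) * ennreal (pmf (K s) r) \<partial>count_space UNIV)
      = ennreal (pmf (bind_pmf P K) r)"
    by (simp add: ennreal_pmf_bind nn_integral_measure_pmf)
  finally show "(\<integral>\<^sup>+ s. ennreal (pmf P s * pmf (K s) r / pmf (bind_pmf P K) r)
      \<partial>count_space UNIV) = 1"
    using pos by (simp add: divide_ennreal)
qed simp

text \<open>Disintegration: the joint law of sample and response is the same whether the sample is
  drawn first, or the response first and then the sample from its posterior.\<close>

lemma bind_posterior_pmf:
  "bind_pmf P (\<lambda>s. bind_pmf (K s) (L s)) =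
    bind_pmf (bind_pmf P K) (\<lambda>r. bind_pmf (posterior_pmf P K r) (\<lambda>s. L s r))"
proof -
  have "bind_pmf P (\<lambda>s. map_pmf (Pair s) (K s)) =
    bind_pmf (bind_pmf P K) (\<lambda>r. map_pmf (\<lambda>s. (s, r)) (posterior_pmf P K r))" (is "?J = ?J'")
  proof (rule pmf_eqI, clarify)
    fix s r
    have "pmf ?J (s, r) = pmf P s * pmf (K s) r"
      by (rule pmf_bind_map_inj) (auto simp: inj_on_def)
    also have "\<dots> = pmf (bind_pmf P K) r * pmf (posterior_pmf P K r) s"
    proof (cases "r \<in> set_pmf (bind_pmf P K)")
      case True
      then show ?thesis
        using pmf_positive[OF True] by (simp add: pmf_posterior_pmf)
    next
      case False
      \<comment> \<open>Here the posterior is unspecified, but it is multiplied by the probability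
        of \<open>r\<close>, which is 0.\<close>
      then have "pmf P s = 0 \<or> pmf (K s) r = 0" "pmf (bind_pmf P K) r = 0"
        by (auto simp only: pmf_eq_0_set_pmf set_bind_pmf UN_iff)
      then show ?thesis by auto
    qed
    also have "\<dots> = pmf ?J' (s, r)"
      by (rule pmf_bind_map_inj[symmetric]) (auto simp: inj_on_def)
    finally show "pmf ?J (s, r) = pmf ?J' (s, r)" .
  qed
  then have "bind_pmf ?J (\<lambda>(s, r). L s r) = bind_pmf ?J' (\<lambda>(s, r). L s r)"
    by simp
  then show ?thesis
    by (simp add: bind_assoc_pmf bind_map_pmf)
qed

text \<open>A response drawn independently of the sample carries no information; this covers the
  coin tosses.\<close>

lemma posterior_pmf_const:
  assumes "r \<in> set_pmf R"
  shows "posterior_pmf P (\<lambda>_. R) r = P"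
  using assms pmf_positive[OF assms] by (intro pmf_eqI) (simp add: pmf_posterior_pmf)

text \<open>Chain rule for posteriors: both sides are proportional in \<open>s\<close> to
  \<open>pmf P s * pmf (K s) v * pmf (L s v) r\<close>, since injectivity of \<open>h\<close> lets
  the combined response reveal both \<open>v\<close> and \<open>r\<close>.\<close>

lemma posterior_pmf_compose:
  fixes h :: "'v \<Rightarrow> 'r \<Rightarrow> 'w"
  assumes h: "inj (\<lambda>(v, r). h v r)"
    and v: "v \<in> set_pmf (bind_pmf P K)"
    and r: "r \<in> set_pmf (bind_pmf (posterior_pmf P K v) (\<lambda>s. L s v))"
  shows "posterior_pmf P (\<lambda>s. bind_pmf (K s) (\<lambda>v. map_pmf (h v) (L s v))) (h v r) =
    posterior_pmf (posterior_pmf P K v) (\<lambda>s. L s v) r"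
proof (rule pmf_eqI)
  fix s
  let ?W = "bind_pmf P K" and ?R = "\<lambda>v. bind_pmf (posterior_pmf P K v) (\<lambda>s. L s v)"
  have law: "bind_pmf P (\<lambda>s. bind_pmf (K s) (\<lambda>v. map_pmf (h v) (L s v))) =
      bind_pmf ?W (\<lambda>v. map_pmf (h v) (?R v))"
    by (simp add: bind_posterior_pmf[of P K "\<lambda>s v. map_pmf (h v) (L s v)"] map_bind_pmf)
  have "h v r \<in> set_pmf (bind_pmf ?W (\<lambda>v. map_pmf (h v) (?R v)))"
    using v r by (simp only: set_bind_pmf set_map_pmf) blast
  then show "pmf (posterior_pmf P (\<lambda>s. bind_pmf (K s) (\<lambda>v. map_pmf (h v) (L s v))) (h v r)) s =
      pmf (posterior_pmf (posterior_pmf P K v) (\<lambda>s. L s v) r) s"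
    unfolding pmf_posterior_pmf[OF r] pmf_posterior_pmf[OF v]
    by (subst pmf_posterior_pmf) (simp_all add: law pmf_bind_map_inj[OF h] del: set_bind_pmf)
qed

section \<open>Stability loss as a statistical distance\<close>

text \<open>Total variation distance; positive parts over the whole type keep the index set
  independent of the two laws.\<close>

definition excess :: "'a pmf \<Rightarrow> 'a pmf \<Rightarrow> real" where
  "excess p q = (\<Sum>\<^sub>\<infinity>x. max 0 (pmf q x - pmf p x))"

lemma excess_summable: "(\<lambda>x. max 0 (pmf q x - pmf p x)) summable_on B"
  by (rule summable_on_comparison_test[OF pmf_summable_on[of q]]) auto

lemma excess_nonneg: "0 \<le> excess p q"
  unfolding excess_def by (rule infsum_nonneg) simp

lemma excess_le_1: "excess p q \<le> 1"
  unfolding excess_def infsum_pmf_eq_1[of q, symmetric]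
  by (rule infsum_mono[OF excess_summable pmf_summable_on]) auto

lemma excess_refl [simp]: "excess p p = 0"
  by (simp add: excess_def)

text \<open>Pointwise subadditivity of the positive part. This lets the losses of successive rounds
  add up.\<close>

lemma excess_triangle: "excess p r \<le> excess p q + excess q r"
  unfolding excess_def infsum_add[OF excess_summable excess_summable, symmetric]
  by (rule infsum_mono[OF excess_summable summable_on_add[OF excess_summable excess_summable]]) auto

text \<open>Realises \<open>elem_prob P\<close> as a distribution, so that losses become distances
  between laws.\<close>

definition elem_pmf :: "('x ^ 'n::finite) pmf \<Rightarrow> 'x pmf" where
  "elem_pmf P = bind_pmf P (\<lambda>s. map_pmf (($) s) (pmf_of_set UNIV))"

lemma pmf_elem_sample: "pmf (map_pmf (($) s) (pmf_of_set UNIV)) x = elem_prob_sample s x"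
  by (simp add: pmf_map measure_pmf_of_set elem_prob_sample_def vimage_def)

lemma pmf_infsum_pmf_eq_bind: "(\<Sum>\<^sub>\<infinity>s. pmf P s * pmf (K s) r) = pmf (bind_pmf P K) r"
proof -
  have "integrable (measure_pmf P) (\<lambda>s. pmf (K s) r)"
    by (rule measure_pmf.integrable_const_bound[where B = 1]) (simp_all add: pmf_le_1)
  from pmf_infsum_eq_integral[OF this, of UNIV] show ?thesis
    by (simp add: pmf_bind)
qed

lemma response_prob_eq: "response_prob M P q r = pmf (bind_pmf P (\<lambda>s. M s q)) r"
  by (simp add: response_prob_def pmf_infsum_pmf_eq_bind)

lemma posterior_eq:
  assumes "r \<in> set_pmf (bind_pmf P (\<lambda>s. M s q))"
  shows "posterior M P q r s = pmf (posterior_pmf P (\<lambda>s. M s q) r) s"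
  by (simp only: posterior_def response_prob_eq pmf_posterior_pmf[OF assms])

lemma elem_prob_eq: "elem_prob P x = pmf (elem_pmf P) x"
  by (simp add: elem_prob_def elem_pmf_def pmf_infsum_pmf_eq_bind flip: pmf_elem_sample)

text \<open>Terms outside the index set of \<open>stability_loss\<close> have positive part 0. The
  support hypothesis makes \<open>posterior\<close> a probability distribution rather than the
  default 0.\<close>

lemma stability_loss_eq_excess:
  assumes "r \<in> set_pmf (bind_pmf P (\<lambda>s. M s q))"
  shows "stability_loss M P q r = excess (elem_pmf P) (elem_pmf (posterior_pmf P (\<lambda>s. M s q) r))"
proof -
  have "elem_prob_response M P q r x = elem_prob (posterior_pmf P (\<lambda>s. M s q) r) x" for x
    by (simp only: elem_prob_response_def elem_prob_def posterior_eq[of r P M q, OF assms])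
  then have "elem_prob_response M P q r x = pmf (elem_pmf (posterior_pmf P (\<lambda>s. M s q) r)) x" for x
    by (simp add: elem_prob_eq)
  then show ?thesis
    unfolding stability_loss_def excess_def elem_prob_eq
    by (intro infsum_cong_neutral) auto
qed

lemma stability_loss_bounds:
  assumes "r \<in> set_pmf (bind_pmf P (\<lambda>s. M s q))"
  shows "0 \<le> stability_loss M P q r" "stability_loss M P q r \<le> 1"
  by (simp_all only: stability_loss_eq_excess[of r P M q, OF assms] excess_nonneg excess_le_1)

section \<open>Tail bounds on the loss versus \<open>LSS\<close>\<close>

lemma integrable_indicator_pmf: "integrable (measure_pmf p) (indicat_real A)"
  by (rule measure_pmf.integrable_const_bound[where B = 1]) auto

lemma integral_indicator_mult_pmf:
  "(\<integral>x. indicat_real A x * c \<partial>measure_pmf p) = c * measure (measure_pmf p) A"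
  by (simp add: integrable_indicator_pmf)

lemma integrable_stability_loss:
  "integrable (measure_pmf (bind_pmf P (\<lambda>s. M s q))) (stability_loss M P q)"
  by (rule measure_pmf.integrable_const_bound[where B = 1])
    (auto simp: AE_measure_pmf_iff stability_loss_bounds simp del: set_bind_pmf)

lemma integrable_indicator_stability_loss:
  "integrable (measure_pmf (bind_pmf P (\<lambda>s. M s q)))
    (\<lambda>r. indicat_real B r * (stability_loss M P q r - c))"
proof -
  have "integrable (measure_pmf (bind_pmf P (\<lambda>s. M s q))) (\<lambda>r. stability_loss M P q r - c)"
    by (intro Bochner_Integration.integrable_diff integrable_stability_loss) simp
  from integrable_real_mult_indicator[OF _ this, of B] show ?thesis
    by (simp add: mult.commute)
qed

lemma LSS_iff_integral:
  "LSS \<epsilon> \<delta> M P q \<longleftrightarrow> (\<forall>B. (\<integral>r. indicat_real B r * (stability_loss M P q r - \<epsilon>)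
      \<partial>measure_pmf (bind_pmf P (\<lambda>s. M s q))) \<le> \<delta>)"
  unfolding LSS_def response_prob_eq
  by (subst pmf_infsum_eq_integral) (simp_all only: integrable_stability_loss
    Bochner_Integration.integrable_diff measure_pmf.integrable_const)

text \<open>Markov's inequality for the excess of the loss over \<open>\<epsilon>\<close>: on the event the excess is at
  least \<open>\<epsilon>\<close>, while its total mass is at most \<open>\<delta>\<close>.\<close>

lemma LSS_prob_le:
  assumes "LSS \<epsilon> \<delta> M P q" and "0 < \<epsilon>"
  shows "measure (measure_pmf (bind_pmf P (\<lambda>s. M s q))) {r. stability_loss M P q r > 2 * \<epsilon>} \<le> \<delta> / \<epsilon>"
proof -
  let ?W = "bind_pmf P (\<lambda>s. M s q)" and ?B = "{r. stability_loss M P q r > 2 * \<epsilon>}"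
  have "\<epsilon> * measure (measure_pmf ?W) ?B = (\<integral>r. indicat_real ?B r * \<epsilon> \<partial>measure_pmf ?W)"
    by (rule integral_indicator_mult_pmf[symmetric])
  also have "\<dots> \<le> (\<integral>r. indicat_real ?B r * (stability_loss M P q r - \<epsilon>) \<partial>measure_pmf ?W)"
    by (intro integral_mono integrable_indicator_stability_loss
        integrable_mult_left integrable_indicator_pmf) (auto simp: indicator_def)
  also have "\<dots> \<le> \<delta>"
    using assms(1) by (simp only: LSS_iff_integral)
  finally show ?thesis
    using assms(2) by (simp add: field_simps)
qed

text \<open>A partial converse: the integrand is at most 0 where the loss is at most
  \<open>\<epsilon>\<close>, and at most 1 elsewhere because losses never exceed 1.\<close>

lemma LSS_if_prob_le:
  assumes "measure (measure_pmf (bind_pmf P (\<lambda>s. M s q))) {r. stability_loss M P q r > \<epsilon>} \<le> \<delta>"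
    and "0 \<le> \<epsilon>"
  shows "LSS \<epsilon> \<delta> M P q"
  unfolding LSS_iff_integral
proof
  fix B
  let ?W = "bind_pmf P (\<lambda>s. M s q)" and ?G = "{r. stability_loss M P q r > \<epsilon>}"
  have "(\<integral>r. indicat_real B r * (stability_loss M P q r - \<epsilon>) \<partial>measure_pmf ?W)
      \<le> (\<integral>r. indicat_real ?G r \<partial>measure_pmf ?W)"
  proof (rule integral_mono_AE)
    show "integrable (measure_pmf ?W) (\<lambda>r. indicat_real B r * (stability_loss M P q r - \<epsilon>))"
      by (rule integrable_indicator_stability_loss)
    show "AE r in measure_pmf ?W. indicat_real B r * (stability_loss M P q r - \<epsilon>) \<le> indicat_real ?G r"
      unfolding AE_measure_pmf_iff
    proof
      fix r assume "r \<in> set_pmf ?W"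
      from stability_loss_bounds(2)[of r P M q, OF this] \<open>0 \<le> \<epsilon>\<close>
      show "indicat_real B r * (stability_loss M P q r - \<epsilon>) \<le> indicat_real ?G r"
        by (auto simp: indicator_def)
    qed
  qed (rule integrable_indicator_pmf)
  also have "\<dots> \<le> \<delta>"
    using assms(1) by simp
  finally show "(\<integral>r. indicat_real B r * (stability_loss M P q r - \<epsilon>) \<partial>measure_pmf ?W) \<le> \<delta>" .
qed

section \<open>The law of the view\<close>

definition view_law :: "(nat \<Rightarrow> ('x, 'n::finite, 'q, 'r) mechanism) \<Rightarrow> ('x ^ 'n) pmf
    \<Rightarrow> ('c, 'r, 'q) analyst \<Rightarrow> nat \<Rightarrow> ('c, 'r) view pmf" where
  "view_law M P A i = bind_pmf P (\<lambda>s. adaptive_mechanism M i s A)"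

definition view_posterior :: "(nat \<Rightarrow> ('x, 'n::finite, 'q, 'r) mechanism) \<Rightarrow> ('x ^ 'n) pmf
    \<Rightarrow> ('c, 'r, 'q) analyst \<Rightarrow> nat \<Rightarrow> ('c, 'r) view \<Rightarrow> ('x ^ 'n) pmf" where
  "view_posterior M P A i v = posterior_pmf P (\<lambda>s. adaptive_mechanism M i s A) v"

text \<open>Conditional law of the response in round \<open>i + 1\<close>; mechanisms are counted
  from 1, hence \<open>M (Suc i)\<close>.\<close>

definition response_law :: "(nat \<Rightarrow> ('x, 'n::finite, 'q, 'r) mechanism) \<Rightarrow> ('x ^ 'n) pmf
    \<Rightarrow> ('c, 'r, 'q) analyst \<Rightarrow> nat \<Rightarrow> ('c, 'r) view \<Rightarrow> 'r pmf" where
  "response_law M P A i v = bind_pmf (view_posterior M P A i v) (\<lambda>s. M (Suc i) s (snd A v))"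

definition extend_view :: "('c, 'r) view \<Rightarrow> 'r \<Rightarrow> ('c, 'r) view" where
  "extend_view v r = (fst v, snd v @ [r])"

lemma inj_extend_view: "inj (\<lambda>(v, r). extend_view v r)"
  by (auto simp: inj_on_def extend_view_def)

lemma adaptive_mechanism_Suc:
  "adaptive_mechanism M (Suc i) s A =
    bind_pmf (adaptive_mechanism M i s A) (\<lambda>v. map_pmf (extend_view v) (M (Suc i) s (snd A v)))"
  by (simp add: extend_view_def[abs_def])

text \<open>By disintegration, a round may be run on a sample redrawn from the current posterior
  without changing the law of the view. So the views form a Markov chain with kernel
  \<open>response_law\<close>.\<close>

lemma view_law_Suc:
  "view_law M P A (Suc i) =
    bind_pmf (view_law M P A i) (\<lambda>v. map_pmf (extend_view v) (response_law M P A i v))"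
  unfolding view_law_def adaptive_mechanism_Suc response_law_def view_posterior_def
  by (subst bind_posterior_pmf) (simp add: map_bind_pmf)

lemma set_view_law_Suc:
  "set_pmf (view_law M P A (Suc i)) =
    {extend_view v r | v r. v \<in> set_pmf (view_law M P A i) \<and> r \<in> set_pmf (response_law M P A i v)}"
  unfolding view_law_Suc by auto

lemma view_posterior_0:
  assumes "v \<in> set_pmf (view_law M P A 0)"
  shows "view_posterior M P A 0 v = P"
  using assms unfolding view_posterior_def view_law_def
  by (auto intro!: posterior_pmf_const)

text \<open>By the chain rule a round updates the posterior through the single mechanism
  \<open>M (Suc i)\<close>, so its loss is one that the hypotheses on that mechanism
  control.\<close>

lemma view_posterior_Suc:
  assumes "v \<in> set_pmf (view_law M P A i)" and "r \<in> set_pmf (response_law M P A i v)"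
  shows "view_posterior M P A (Suc i) (extend_view v r) =
    posterior_pmf (view_posterior M P A i v) (\<lambda>s. M (Suc i) s (snd A v)) r"
  using assms unfolding view_posterior_def view_law_def response_law_def adaptive_mechanism_Suc
  by (intro posterior_pmf_compose[OF inj_extend_view])

lemma fst_view_law:
  assumes "v \<in> set_pmf (view_law M P A i)"
  shows "fst v \<in> set_pmf (fst A)"
  using assms
proof (induction i arbitrary: v)
  case 0
  then show ?case by (auto simp: view_law_def)
next
  case (Suc i)
  then show ?case by (auto simp: set_view_law_Suc extend_view_def)
qed

lemma query_view_law:
  assumes "issues_queries_in A Q" and "v \<in> set_pmf (view_law M P A i)"
  shows "snd A v \<in> Q"
  using assms(1) fst_view_law[OF assms(2)] unfolding issues_queries_in_def
  by (metis prod.collapse)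

text \<open>A reachable view is built from queries in \<open>Q\<close> and responses of positive
  conditional probability, which are the steps that generate the family. Stage \<open>i\<close> is
  the one to which the hypotheses on mechanism \<open>Suc i\<close> refer.\<close>

lemma view_posterior_in_family:
  assumes "P \<in> \<D>" and "issues_queries_in A Q" and "v \<in> set_pmf (view_law M P A i)"
  shows "view_posterior M P A i v \<in> posterior_family M Q \<D> i"
  using assms(3)
proof (induction i arbitrary: v)
  case 0
  then show ?case using assms(1) by (simp add: view_posterior_0)
next
  case (Suc i)
  then obtain u r where v: "v = extend_view u r"
    and u: "u \<in> set_pmf (view_law M P A i)" and r: "r \<in> set_pmf (response_law M P A i u)"
    by (auto simp: set_view_law_Suc)
  let ?P = "view_posterior M P A i u"
  have r': "r \<in> set_pmf (bind_pmf ?P (\<lambda>s. M (Suc i) s (snd A u)))"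
    using r by (simp only: response_law_def)
  have "response_prob (M (Suc i)) ?P (snd A u) r > 0"
    using pmf_positive[OF r'] by (simp only: response_prob_eq)
  moreover have "pmf (view_posterior M P A (Suc i) v) s = posterior (M (Suc i)) ?P (snd A u) r s" for s
    by (simp only: v view_posterior_Suc[OF u r] posterior_eq[of r ?P "M (Suc i)", OF r'])
  ultimately show ?case
    using Suc.IH[OF u] query_view_law[OF assms(2) u] by auto
qed

section \<open>Concentration of the accumulated loss\<close>

text \<open>Hoeffding's lemma on the interval from 0 to \<open>b\<close>. Clipping only lowers the
  mean, so centring at \<open>a\<close> instead of the clipped mean cannot increase the
  exponential.\<close>

lemma nn_integral_exp_clipped_le:
  fixes f :: "'a \<Rightarrow> real"
  assumes f: "\<And>x. x \<in> set_pmf R \<Longrightarrow> 0 \<le> f x \<and> f x \<le> 1"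
    and mean: "measure_pmf.expectation R f \<le> a" and "0 < b" and "0 < l"
  shows "(\<integral>\<^sup>+x. ennreal (exp (l * (min (f x) b - a))) \<partial>measure_pmf R) \<le> ennreal (exp (l\<^sup>2 * b\<^sup>2 / 8))"
proof -
  let ?g = "\<lambda>x. min (f x) b"
  interpret interval_bounded_random_variable "measure_pmf R" ?g 0 b
    using f \<open>0 < b\<close> by unfold_locales (auto simp: AE_measure_pmf_iff)
  have "measure_pmf.expectation R ?g \<le> measure_pmf.expectation R f"
  proof (rule integral_mono_AE)
    show "integrable (measure_pmf R) f"
      using f by (intro measure_pmf.integrable_const_bound[where B = 1]) (auto simp: AE_measure_pmf_iff)
  qed (auto simp: integrable)
  then have "?g x - a \<le> ?g x - measure_pmf.expectation R ?g" for x
    using mean by simp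
  then have "(\<integral>\<^sup>+x. ennreal (exp (l * (?g x - a))) \<partial>measure_pmf R)
      \<le> (\<integral>\<^sup>+x. ennreal (exp (l * (?g x - measure_pmf.expectation R ?g))) \<partial>measure_pmf R)"
    using \<open>0 < l\<close> by (intro nn_integral_mono ennreal_leI) auto
  also have "\<dots> \<le> ennreal (exp (l\<^sup>2 * (b - 0)\<^sup>2 / 8))"
    by (rule Hoeffdings_lemma_nn_integral[OF \<open>0 < l\<close>])
  finally show ?thesis by simp
qed

text \<open>Averages a conditional bound that is uniform over the reachable first outcomes; the bad
  set \<open>B x\<close> may depend on that outcome.\<close>

lemma measure_bind_pmf_le:
  assumes "\<And>x. x \<in> set_pmf p \<Longrightarrow> measure (measure_pmf (K x)) (B x) \<le> c" and "0 \<le> c"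
    and "\<And>x y. x \<in> set_pmf p \<Longrightarrow> y \<in> set_pmf (K x) \<Longrightarrow> h x y \<in> G \<Longrightarrow> y \<in> B x"
  shows "measure (measure_pmf (bind_pmf p (\<lambda>x. map_pmf (h x) (K x)))) G \<le> c"
proof -
  have "measure (measure_pmf (K x)) (h x -` G) \<le> c" if "x \<in> set_pmf p" for x
  proof -
    have "measure (measure_pmf (K x)) (h x -` G) \<le> measure (measure_pmf (K x)) (B x)"
      using assms(3)[OF that]
      by (intro measure_pmf.finite_measure_mono_AE) (auto simp: AE_measure_pmf_iff)
    with assms(1)[OF that] show ?thesis by simp
  qed
  then have "emeasure (measure_pmf (bind_pmf p (\<lambda>x. map_pmf (h x) (K x)))) G
      \<le> (\<integral>\<^sup>+x. ennreal c \<partial>measure_pmf p)"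
    unfolding emeasure_bind_pmf
    by (intro nn_integral_mono_AE)
      (auto simp: AE_measure_pmf_iff measure_pmf.emeasure_eq_measure intro!: ennreal_leI)
  then show ?thesis
    using \<open>0 \<le> c\<close> by (simp add: measure_pmf.emeasure_eq_measure)
qed

text \<open>\<open>Z\<close> is the sum of the step losses clipped at \<open>2 * \<epsilon> j\<close>, and \<open>G\<close> is the set of views where
  some clipping is effective.\<close>

lemma view_loss_exponential_moment:
  fixes M :: "nat \<Rightarrow> ('x, 'n::finite, 'q, 'r) mechanism" and A :: "('c, 'r, 'q) analyst"
  assumes \<epsilon>: "\<And>i. i \<in> {1..k} \<Longrightarrow> 0 < \<epsilon> i"
    and \<delta>: "\<And>i. i \<in> {1..k} \<Longrightarrow> 0 \<le> \<delta> i"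
    and LSS: "\<And>i. i \<in> {1..k} \<Longrightarrow> LSS_family (\<epsilon> i) (\<delta> i) (M i) (posterior_family M Q \<D> (i - 1)) Q"
    and \<alpha>: "\<And>i P q. i \<in> {1..k} \<Longrightarrow> P \<in> posterior_family M Q \<D> (i - 1) \<Longrightarrow> q \<in> Q \<Longrightarrow>
           expected_stability_loss (M i) P q \<le> \<alpha> i"
    and Q: "issues_queries_in A Q" and P: "P \<in> \<D>" and l: "0 < l" and "i \<le> k"
  shows "\<exists>Z G.
    (\<forall>v\<in>set_pmf (view_law M P A i). v \<notin> G \<longrightarrow>
      excess (elem_pmf P) (elem_pmf (view_posterior M P A i v)) \<le> Z v) \<and>
    measure (measure_pmf (view_law M P A i)) G \<le> (\<Sum>j=1..i. \<delta> j / \<epsilon> j) \<and>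
    (\<integral>\<^sup>+v. ennreal (exp (l * (Z v - (\<Sum>j=1..i. \<alpha> j)))) \<partial>measure_pmf (view_law M P A i))
      \<le> ennreal (exp (l\<^sup>2 / 2 * (\<Sum>j=1..i. (\<epsilon> j)\<^sup>2)))"
  using \<open>i \<le> k\<close>
proof (induction i)
  case 0
  show ?case
    by (rule exI[of _ "\<lambda>_. 0"], rule exI[of _ "{}"]) (auto simp: view_posterior_0)
next
  case (Suc i)
  let ?W = "view_law M P A" and ?post = "view_posterior M P A" and ?R = "response_law M P A i"
  let ?a = "\<Sum>j=1..i. \<alpha> j"
  define loss where "loss = (\<lambda>v. stability_loss (M (Suc i)) (?post i v) (snd A v))"
  \<comment> \<open>\<open>prev\<close> and \<open>last\<close> recover the preceding view and the
    newest response, so that the new bound and the new bad set are functions of the view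
    alone.\<close>
  define prev :: "('c, 'r) view \<Rightarrow> ('c, 'r) view" where "prev = (\<lambda>v. (fst v, butlast (snd v)))"
  have prev [simp]: "prev (extend_view v r) = v" "last (snd (extend_view v r)) = r" for v r
    by (simp_all add: prev_def extend_view_def)
  obtain Z G where
    Z: "\<And>v. v \<in> set_pmf (?W i) \<Longrightarrow> v \<notin> G \<Longrightarrow> excess (elem_pmf P) (elem_pmf (?post i v)) \<le> Z v"
    and G: "measure (measure_pmf (?W i)) G \<le> (\<Sum>j=1..i. \<delta> j / \<epsilon> j)"
    and mgf: "(\<integral>\<^sup>+v. ennreal (exp (l * (Z v - ?a))) \<partial>measure_pmf (?W i))
      \<le> ennreal (exp (l\<^sup>2 / 2 * (\<Sum>j=1..i. (\<epsilon> j)\<^sup>2)))"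
    using Suc by auto
  \<comment> \<open>Off \<open>G'\<close> the clipping is inactive, so there \<open>Z'\<close>
    contains the full loss of the round.\<close>
  define Z' where "Z' = (\<lambda>w. Z (prev w) + min (loss (prev w) (last (snd w))) (2 * \<epsilon> (Suc i)))"
  define G' where "G' = {w. loss (prev w) (last (snd w)) > 2 * \<epsilon> (Suc i)}"
  have Suc_i: "Suc i \<in> {1..k}" using Suc.prems by simp
  note \<epsilon>' = \<epsilon>[OF Suc_i]
  have family: "?post i v \<in> posterior_family M Q \<D> (Suc i - 1)" "snd A v \<in> Q"
    if "v \<in> set_pmf (?W i)" for v
    using view_posterior_in_family[OF P Q that] query_view_law[OF Q that] by simp_all
  have loss_prob: "measure (measure_pmf (?R v)) {r. loss v r > 2 * \<epsilon> (Suc i)} \<le> \<delta> (Suc i) / \<epsilon> (Suc i)"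
    if "v \<in> set_pmf (?W i)" for v
    unfolding response_law_def loss_def
    using LSS[OF Suc_i] family[OF that] by (intro LSS_prob_le[OF _ \<epsilon>']) (auto simp: LSS_family_def)
  have loss_mgf: "(\<integral>\<^sup>+r. ennreal (exp (l * (min (loss v r) (2 * \<epsilon> (Suc i)) - \<alpha> (Suc i)))) \<partial>measure_pmf (?R v))
      \<le> ennreal (exp (l\<^sup>2 / 2 * (\<epsilon> (Suc i))\<^sup>2))" if v: "v \<in> set_pmf (?W i)" for v
  proof -
    \<comment> \<open>The clipping width \<open>b = 2 * \<epsilon> (Suc i)\<close> turns Hoeffding's
      \<open>l^2 * b^2 / 8\<close> into \<open>l^2 / 2\<close> times the square of
      \<open>\<epsilon> (Suc i)\<close>.\<close>
    have "(\<integral>\<^sup>+r. ennreal (exp (l * (min (loss v r) (2 * \<epsilon> (Suc i)) - \<alpha> (Suc i)))) \<partial>measure_pmf (?R v))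
        \<le> ennreal (exp (l\<^sup>2 * (2 * \<epsilon> (Suc i))\<^sup>2 / 8))"
    proof (rule nn_integral_exp_clipped_le)
      fix r assume "r \<in> set_pmf (?R v)"
      then have "r \<in> set_pmf (bind_pmf (?post i v) (\<lambda>s. M (Suc i) s (snd A v)))"
        by (simp only: response_law_def)
      from stability_loss_bounds[of r _ "M (Suc i)", OF this]
      show "0 \<le> loss v r \<and> loss v r \<le> 1" by (simp add: loss_def)
    next
      show "measure_pmf.expectation (?R v) (loss v) \<le> \<alpha> (Suc i)"
        using \<alpha>[OF Suc_i family[OF v]]
        by (simp only: expected_stability_loss_def response_law_def loss_def)
    qed (use \<epsilon>' l in simp_all)
    then show ?thesis by (simp add: power_mult_distrib)
  qed
  have loss_excess: "loss v r = excess (elem_pmf (?post i v)) (elem_pmf (?post (Suc i) (extend_view v r)))"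
    if "v \<in> set_pmf (?W i)" "r \<in> set_pmf (?R v)" for v r
    unfolding view_posterior_Suc[OF that] loss_def
    by (rule stability_loss_eq_excess) (use that(2) in \<open>simp only: response_law_def\<close>)
  show ?case
  \<comment> \<open>The first case fixes the witnesses: \<open>Z'\<close>, and the preimage of
    \<open>G\<close> under \<open>prev\<close> together with \<open>G'\<close>.\<close>
  proof (intro exI conjI ballI impI)
    fix w assume "w \<in> set_pmf (?W (Suc i))" and w_good: "w \<notin> prev -` G \<union> G'"
    then obtain v r where w: "w = extend_view v r" and v: "v \<in> set_pmf (?W i)"
      and r: "r \<in> set_pmf (?R v)"
      by (auto simp: set_view_law_Suc)
    have "excess (elem_pmf P) (elem_pmf (?post (Suc i) w)) \<le>
        excess (elem_pmf P) (elem_pmf (?post i v)) + loss v r"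
      unfolding w loss_excess[OF v r] by (rule excess_triangle)
    moreover have "v \<notin> G" "loss v r \<le> 2 * \<epsilon> (Suc i)"
      using w_good by (simp_all add: G'_def w)
    ultimately show "excess (elem_pmf P) (elem_pmf (?post (Suc i) w)) \<le> Z' w"
      using Z[OF v] by (simp add: Z'_def w)
  next
    \<comment> \<open>Forgetting the last response restores the earlier law, so the preimage of
      \<open>G\<close> has the probability of \<open>G\<close>.\<close>
    have "map_pmf prev (?W (Suc i)) = ?W i"
      by (simp add: view_law_Suc map_bind_pmf pmf.map_comp comp_def bind_return_pmf')
    then have "measure (measure_pmf (?W (Suc i))) (prev -` G) = measure (measure_pmf (?W i)) G"
      by (metis measure_map_pmf)
    moreover have "measure (measure_pmf (?W (Suc i))) G' \<le> \<delta> (Suc i) / \<epsilon> (Suc i)"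
      unfolding view_law_Suc
      by (rule measure_bind_pmf_le[OF loss_prob]) (use \<epsilon>' \<delta>[OF Suc_i] in \<open>auto simp: G'_def\<close>)
    moreover have "measure (measure_pmf (?W (Suc i))) (prev -` G \<union> G') \<le>
        measure (measure_pmf (?W (Suc i))) (prev -` G) + measure (measure_pmf (?W (Suc i))) G'"
      by (rule measure_Un_le) auto
    ultimately show "measure (measure_pmf (?W (Suc i))) (prev -` G \<union> G') \<le> (\<Sum>j=1..Suc i. \<delta> j / \<epsilon> j)"
      using G by simp
  next
    \<comment> \<open>Given \<open>v\<close> the first factor is constant, so the inner integral is
      bounded by \<open>loss_mgf\<close> uniformly in reachable \<open>v\<close>, and the outer one
      by \<open>mgf\<close>.\<close>
    have split: "ennreal (exp (l * (Z' (extend_view v r) - (\<Sum>j=1..Suc i. \<alpha> j)))) =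
        ennreal (exp (l * (Z v - ?a))) *
        ennreal (exp (l * (min (loss v r) (2 * \<epsilon> (Suc i)) - \<alpha> (Suc i))))" for v r
      by (simp add: Z'_def algebra_simps flip: ennreal_mult exp_add)
    have "(\<integral>\<^sup>+w. ennreal (exp (l * (Z' w - (\<Sum>j=1..Suc i. \<alpha> j)))) \<partial>measure_pmf (?W (Suc i))) =
        (\<integral>\<^sup>+v. ennreal (exp (l * (Z v - ?a))) *
          (\<integral>\<^sup>+r. ennreal (exp (l * (min (loss v r) (2 * \<epsilon> (Suc i)) - \<alpha> (Suc i)))) \<partial>measure_pmf (?R v))
          \<partial>measure_pmf (?W i))"
      unfolding view_law_Suc nn_integral_bind_pmf nn_integral_map_pmf split
      by (simp add: nn_integral_cmult)
    also have "\<dots> \<le> (\<integral>\<^sup>+v. ennreal (exp (l * (Z v - ?a))) * ennreal (exp (l\<^sup>2 / 2 * (\<epsilon> (Suc i))\<^sup>2))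
          \<partial>measure_pmf (?W i))"
      by (intro nn_integral_mono_AE AE_pmfI mult_left_mono loss_mgf) auto
    also have "\<dots> \<le> ennreal (exp (l\<^sup>2 / 2 * (\<Sum>j=1..i. (\<epsilon> j)\<^sup>2))) * ennreal (exp (l\<^sup>2 / 2 * (\<epsilon> (Suc i))\<^sup>2))"
      by (subst nn_integral_multc) (simp, intro mult_right_mono mgf zero_le)
    also have "\<dots> = ennreal (exp (l\<^sup>2 / 2 * (\<Sum>j=1..Suc i. (\<epsilon> j)\<^sup>2)))"
      by (simp add: algebra_simps flip: ennreal_mult exp_add)
    finally show "(\<integral>\<^sup>+w. ennreal (exp (l * (Z' w - (\<Sum>j=1..Suc i. \<alpha> j)))) \<partial>measure_pmf (?W (Suc i)))
      \<le> ennreal (exp (l\<^sup>2 / 2 * (\<Sum>j=1..Suc i. (\<epsilon> j)\<^sup>2)))" .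
  qed
qed

text \<open>Exponential Markov inequality: the indicator of \<open>f x > t\<close> is at most
  \<open>exp (l * (f x - t))\<close>.\<close>

lemma pmf_Chernoff_bound:
  assumes "(\<integral>\<^sup>+x. ennreal (exp (l * f x)) \<partial>measure_pmf p) \<le> ennreal (exp c)" and "0 < l"
  shows "measure (measure_pmf p) {x. f x > t} \<le> exp (c - l * t)"
proof -
  have "emeasure (measure_pmf p) {x. f x > t} = (\<integral>\<^sup>+x. indicator {x. f x > t} x \<partial>measure_pmf p)"
    by simp
  also have "\<dots> \<le> (\<integral>\<^sup>+x. ennreal (exp (- l * t)) * ennreal (exp (l * f x)) \<partial>measure_pmf p)"
    using \<open>0 < l\<close>
    by (intro nn_integral_mono)
      (auto simp: indicator_def one_le_exp_iff simp flip: ennreal_mult exp_add ennreal_1 intro!: ennreal_leI)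
  also have "\<dots> \<le> ennreal (exp (- l * t)) * ennreal (exp c)"
    by (subst nn_integral_cmult) (auto intro!: mult_left_mono assms(1))
  also have "\<dots> = ennreal (exp (c - l * t))"
    by (simp add: algebra_simps flip: ennreal_mult exp_add)
  finally show ?thesis
    by (simp add: measure_pmf.emeasure_eq_measure)
qed

section \<open>Choice of the exponent and conclusion\<close>

theorem theorem2p10:
  fixes M :: "nat \<Rightarrow> ('x::countable, 'n::finite, 'q::countable, 'r::countable) mechanism"
    and \<D> :: "('x ^ 'n) pmf set" and Q :: "'q set" and k :: nat
    and \<epsilon> \<delta> \<alpha> :: "nat \<Rightarrow> real" and \<delta>' :: real
    and A :: "('c, 'r, 'q) analyst"
  assumes "\<And>i. i \<in> {1..k} \<Longrightarrow> 0 < \<epsilon> i \<and> \<epsilon> i \<le> 1"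
    and "\<And>i. i \<in> {1..k} \<Longrightarrow> 0 \<le> \<delta> i \<and> \<delta> i \<le> 1"
    and "\<And>i. i \<in> {1..k} \<Longrightarrow> LSS_family (\<epsilon> i) (\<delta> i) (M i) (posterior_family M Q \<D> (i - 1)) Q"
    and "\<And>i. i \<in> {1..k} \<Longrightarrow> 0 \<le> \<alpha> i \<and> \<alpha> i \<le> 1"
    and "\<And>i P q. i \<in> {1..k} \<Longrightarrow> P \<in> posterior_family M Q \<D> (i - 1) \<Longrightarrow> q \<in> Q \<Longrightarrow>
           expected_stability_loss (M i) P q \<le> \<alpha> i"
    and "0 < \<delta>'" and "\<delta>' \<le> 1"
    and "issues_queries_in A Q"
  shows "k_LSS_family k
           (sqrt (8 * ln (1 / \<delta>') * (\<Sum>i=1..k. (\<epsilon> i)\<^sup>2)) + (\<Sum>i=1..k. \<alpha> i))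
           (\<delta>' + (\<Sum>i=1..k. \<delta> i / \<epsilon> i)) M \<D> A"
  unfolding k_LSS_family_def k_LSS_def
proof
  fix P assume P: "P \<in> \<D>"
  define S where "S = (\<Sum>i=1..k. (\<epsilon> i)\<^sup>2)"
  define t where "t = sqrt (8 * ln (1 / \<delta>') * S)"
  define a where "a = (\<Sum>i=1..k. \<alpha> i)"
  let ?W = "view_law M P A k"
  let ?loss = "stability_loss (adaptive_mechanism M k) P A"
  have a: "0 \<le> a" using assms(4) unfolding a_def by (intro sum_nonneg) auto
  have S: "0 \<le> S" unfolding S_def by (intro sum_nonneg) auto
  have log: "0 \<le> ln (1 / \<delta>')" using assms(6,7) by (intro ln_ge_zero) simp
  have t: "0 \<le> t" using S log by (simp add: t_def)
  have sum: "0 \<le> (\<Sum>i=1..k. \<delta> i / \<epsilon> i)"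
    using assms(1,2) by (intro sum_nonneg divide_nonneg_nonneg) (auto intro: less_imp_le)
  have loss: "?loss v = excess (elem_pmf P) (elem_pmf (view_posterior M P A k v))"
    if "v \<in> set_pmf ?W" for v
    unfolding view_posterior_def
    by (rule stability_loss_eq_excess) (use that in \<open>simp only: view_law_def\<close>)
  \<comment> \<open>By \<open>LSS_if_prob_le\<close> it is enough to bound the probability that the
    loss exceeds \<open>t + a\<close>.\<close>
  have "measure (measure_pmf ?W) {v. ?loss v > t + a} \<le> \<delta>' + (\<Sum>i=1..k. \<delta> i / \<epsilon> i)"
  \<comment> \<open>If \<open>k = 0\<close> then \<open>S = 0\<close>, and if
    \<open>\<delta>' = 1\<close> then \<open>t = 0\<close>, so \<open>t / S\<close> is not a
    positive exponent. In the first case the loss vanishes on the support; in the second the claimed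
    bound is at least 1.\<close>
  proof (cases "k = 0 \<or> \<delta>' = 1")
    case True
    then show ?thesis
    proof
      assume k: "k = 0"
      have "measure (measure_pmf ?W) {v. ?loss v > t + a} = 0"
        using a t loss view_posterior_0[of _ M P A]
        by (auto simp: k measure_pmf_zero_iff)
      then show ?thesis using sum assms(6) by simp
    next
      assume "\<delta>' = 1"
      then show ?thesis
        using sum measure_pmf.prob_le_1[of ?W "{v. ?loss v > t + a}"] by linarith
    qed
  next
    case False
    have S_pos: "0 < S"
      unfolding S_def using False assms(1) by (intro sum_pos) (auto simp: less_imp_neq[THEN not_sym])
    have log_pos: "0 < ln (1 / \<delta>')"
      using False assms(6,7) by (intro ln_gt_zero) simp
    \<comment> \<open>This \<open>l\<close> minimises \<open>l^2 / 2 * S - l * t\<close>, with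
      minimum \<open>- t^2 / (2 * S)\<close>.\<close>
    define l where "l = t / S"
    have t2: "t\<^sup>2 = 8 * ln (1 / \<delta>') * S"
      using S log by (simp add: t_def)
    have l: "0 < l"
      using S_pos log_pos by (simp add: l_def t_def)
    have "l\<^sup>2 / 2 * S - l * t = - (t\<^sup>2 / S) / 2"
      using S_pos by (simp add: l_def power2_eq_square field_simps)
    also have "\<dots> = - 4 * ln (1 / \<delta>')"
      using S_pos by (simp add: t2)
    \<comment> \<open>The 8 inside \<open>t\<close> produced the factor 4, which may be dropped as
      the logarithm is nonnegative.\<close>
    also have "\<dots> \<le> - ln (1 / \<delta>')"
      using log by simp
    finally have exponent: "exp (l\<^sup>2 / 2 * S - l * t) \<le> \<delta>'"
      using assms(6) by (simp add: ln_div) (metis exp_le_cancel_iff exp_ln)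
    have "\<exists>Z G. (\<forall>v\<in>set_pmf ?W. v \<notin> G \<longrightarrow>
          excess (elem_pmf P) (elem_pmf (view_posterior M P A k v)) \<le> Z v) \<and>
        measure (measure_pmf ?W) G \<le> (\<Sum>j=1..k. \<delta> j / \<epsilon> j) \<and>
        (\<integral>\<^sup>+v. ennreal (exp (l * (Z v - a))) \<partial>measure_pmf ?W) \<le> ennreal (exp (l\<^sup>2 / 2 * S))"
      unfolding S_def a_def
      by (rule view_loss_exponential_moment[OF _ _ assms(3) assms(5) assms(8) P l order.refl])
        (use assms(1,2) in auto)
    then obtain Z G where
      Z: "\<And>v. v \<in> set_pmf ?W \<Longrightarrow> v \<notin> G \<Longrightarrow>
        excess (elem_pmf P) (elem_pmf (view_posterior M P A k v)) \<le> Z v"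
      and G: "measure (measure_pmf ?W) G \<le> (\<Sum>j=1..k. \<delta> j / \<epsilon> j)"
      and mgf: "(\<integral>\<^sup>+v. ennreal (exp (l * (Z v - a))) \<partial>measure_pmf ?W) \<le> ennreal (exp (l\<^sup>2 / 2 * S))"
      by auto
    \<comment> \<open>Outside \<open>G\<close> the loss is at most \<open>Z v\<close>, so a loss
      above \<open>t + a\<close> forces \<open>Z v - a > t\<close>.\<close>
    have "measure (measure_pmf ?W) {v. ?loss v > t + a} \<le>
        measure (measure_pmf ?W) (G \<union> {v. Z v - a > t})"
    proof (rule measure_pmf.finite_measure_mono_AE)
      show "AE v in measure_pmf ?W. v \<in> {v. ?loss v > t + a} \<longrightarrow> v \<in> G \<union> {v. Z v - a > t}"
        unfolding AE_measure_pmf_iff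
      proof (intro ballI impI)
        fix v assume v: "v \<in> set_pmf ?W" and "v \<in> {v. ?loss v > t + a}"
        then have "excess (elem_pmf P) (elem_pmf (view_posterior M P A k v)) > t + a"
          by (simp add: loss)
        with Z[OF v] show "v \<in> G \<union> {v. Z v - a > t}"
          by fastforce
      qed
    qed simp
    also have "\<dots> \<le> measure (measure_pmf ?W) G + measure (measure_pmf ?W) {v. Z v - a > t}"
      by (rule measure_Un_le) auto
    also have "\<dots> \<le> (\<Sum>j=1..k. \<delta> j / \<epsilon> j) + \<delta>'"
      using G pmf_Chernoff_bound[OF mgf l, of t] exponent by linarith
    finally show ?thesis by simp
  qed
  then have "LSS (t + a) (\<delta>' + (\<Sum>i=1..k. \<delta> i / \<epsilon> i)) (adaptive_mechanism M k) P A"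
    using a t by (intro LSS_if_prob_le) (auto simp only: view_law_def)
  then show "LSS (sqrt (8 * ln (1 / \<delta>') * (\<Sum>i=1..k. (\<epsilon> i)\<^sup>2)) + (\<Sum>i=1..k. \<alpha> i))
      (\<delta>' + (\<Sum>i=1..k. \<delta> i / \<epsilon> i)) (adaptive_mechanism M k) P A"
    by (simp only: t_def S_def a_def)
qed

end
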